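(* Let $\mathbf{L}=\langle L,\leq\rangle$ be a complete algebraic lattice with $K$ its set of compact elements, let $S$ be a compact $L$-parameterization, and let $C\colon L\to L$ be an algebraic $S$-closure operator. Put $\Sigma_C=\{a\Rightarrow b;\ a,b\in K,\ b\leq C(a)\}$. Then $C=C_{\Sigma_C}$.
   Context: An isotone Galois connection in $\mathbf{L}$ is a pair $\langle f,h\rangle$ of maps $L\to L$ with $f(a)\leq b$ iff $a\leq h(b)$. An $L$-parameterization is a set $S$ of isotone Galois connections containing $\langle\mathrm{id},\mathrm{id}\rangle$; compact if $f(a)\in K$ whenever $a\in K$, $\langle f,h\rangle\in S$. An $S$-closure operator is $C\colon L\to L$ with $a\leq C(a)$, $a\leq b\Rightarrow C(a)\leq C(b)$, and $C(h(C(a)))\leq h(C(a))$ for all $a,b\in L$, $\langle f,h\rangle\in S$; it is algebraic if $C(a)=\bigvee\{C(c);\ c\in K, c\leq a\}$ for all $a\in L$. A formula is a pair $a\Rightarrow b$ with $a,b\in K$. $S$-inference rules, for $a,b,c,d\in K$, $\langle f,h\rangle\in S$: infer $a\vee b\Rightarrow b$; from $a\Rightarrow b$ and $b\vee c\Rightarrow d$ infer $a\vee c\Rightarrow d$; from $a\Rightarrow b$ infer $f(a)\Rightarrow f(b)$. $\Sigma\vdash a\Rightarrow b$ means existence of a finite proof from $\Sigma$ using these rules. $C_\Sigma(a)=\bigvee\{b\in K;\ \Sigma\vdash c\Rightarrow b$ for some $c\in K$, $c\leq a\}$. *)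

theory Defs
  imports Main
begin

definition compact_elems :: "'a::complete_lattice set" where
  "compact_elems = {k. \<forall>A. k \<le> Sup A \<longrightarrow> (\<exists>F. finite F \<and> F \<subseteq> A \<and> k \<le> Sup F)}"

definition algebraic_lattice :: "'a::complete_lattice itself \<Rightarrow> bool" where
  "algebraic_lattice _ \<longleftrightarrow> (\<forall>a::'a. \<exists>A \<subseteq> compact_elems. a = Sup A)"

definition isotone_galois :: "('a::complete_lattice \<Rightarrow> 'a) \<Rightarrow> ('a \<Rightarrow> 'a) \<Rightarrow> bool" where
  "isotone_galois f h \<longleftrightarrow> (\<forall>a b. f a \<le> b \<longleftrightarrow> a \<le> h b)"

type_synonym 'a param = "(('a \<Rightarrow> 'a) \<times> ('a \<Rightarrow> 'a)) set"

definition L_parameterization :: "'a::complete_lattice param \<Rightarrow> bool" where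
  "L_parameterization S \<longleftrightarrow> (\<forall>(f, h) \<in> S. isotone_galois f h) \<and> (id, id) \<in> S"

definition compact_L_parameterization :: "'a::complete_lattice param \<Rightarrow> bool" where
  "compact_L_parameterization S \<longleftrightarrow>
     L_parameterization S \<and> (\<forall>(f, h) \<in> S. \<forall>a \<in> compact_elems. f a \<in> compact_elems)"

definition S_closure_operator :: "'a::complete_lattice param \<Rightarrow> ('a \<Rightarrow> 'a) \<Rightarrow> bool" where
  "S_closure_operator S C \<longleftrightarrow>
     (\<forall>a. a \<le> C a) \<and>
     (\<forall>a b. a \<le> b \<longrightarrow> C a \<le> C b) \<and>
     (\<forall>a. \<forall>(f, h) \<in> S. C (h (C a)) \<le> h (C a))"

definition algebraic_S_closure_operator :: "'a::complete_lattice param \<Rightarrow> ('a \<Rightarrow> 'a) \<Rightarrow> bool" where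
  "algebraic_S_closure_operator S C \<longleftrightarrow>
     S_closure_operator S C \<and> (\<forall>a. C a = Sup {C c | c. c \<in> compact_elems \<and> c \<le> a})"

text \<open>The formula \<open>a \<Rightarrow> b\<close> is represented by the pair \<open>(a, b)\<close>. In \<open>S_infers S P \<phi>\<close>,
  \<open>P\<close> is the set of formulas available as premises of a single rule application.\<close>

inductive S_infers ::
  "'a::complete_lattice param \<Rightarrow> ('a \<times> 'a) set \<Rightarrow> 'a \<times> 'a \<Rightarrow> bool"
  for S P where
  ax: "a \<in> compact_elems \<Longrightarrow> b \<in> compact_elems \<Longrightarrow> S_infers S P (sup a b, b)"
| cut: "a \<in> compact_elems \<Longrightarrow> b \<in> compact_elems \<Longrightarrow> c \<in> compact_elems \<Longrightarrow> d \<in> compact_elems \<Longrightarrow>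
    (a, b) \<in> P \<Longrightarrow> (sup b c, d) \<in> P \<Longrightarrow> S_infers S P (sup a c, d)"
| mul: "a \<in> compact_elems \<Longrightarrow> b \<in> compact_elems \<Longrightarrow> (f, h) \<in> S \<Longrightarrow>
    (a, b) \<in> P \<Longrightarrow> S_infers S P (f a, f b)"

definition is_S_proof ::
  "'a::complete_lattice param \<Rightarrow> ('a \<times> 'a) set \<Rightarrow> ('a \<times> 'a) list \<Rightarrow> bool" where
  "is_S_proof S \<Sigma> p \<longleftrightarrow>
     (\<forall>i < length p. p ! i \<in> \<Sigma> \<or> S_infers S (set (take i p)) (p ! i))"

definition S_provable ::
  "'a::complete_lattice param \<Rightarrow> ('a \<times> 'a) set \<Rightarrow> 'a \<Rightarrow> 'a \<Rightarrow> bool" where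
  "S_provable S \<Sigma> a b \<longleftrightarrow> (\<exists>p. is_S_proof S \<Sigma> p \<and> p \<noteq> [] \<and> last p = (a, b))"

definition closure_of_theory ::
  "'a::complete_lattice param \<Rightarrow> ('a \<times> 'a) set \<Rightarrow> 'a \<Rightarrow> 'a" where
  "closure_of_theory S \<Sigma> a =
     Sup {b \<in> compact_elems. \<exists>c \<in> compact_elems. c \<le> a \<and> S_provable S \<Sigma> c b}"

definition theory_of_closure :: "('a::complete_lattice \<Rightarrow> 'a) \<Rightarrow> ('a \<times> 'a) set" where
  "theory_of_closure C = {(a, b). a \<in> compact_elems \<and> b \<in> compact_elems \<and> b \<le> C a}"

end

theory Submission
  imports Defs
begin

text \<open>Soundness: the formulas (x, y) with \<open>y \<le> C x\<close> are closed under the inference rules; the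
  cut rule uses idempotence of \<open>C\<close> (the defining inequality for \<open>(id, id)\<close>), and the
  multiplication rule uses adjointness together with the fact that \<open>h (C (f a))\<close> is a fixed point
  of \<open>C\<close>. Completeness: \<open>C a\<close> is the join of the \<open>C c\<close> for compact \<open>c \<le> a\<close>, and each \<open>C c\<close> is
  the join of the compact elements \<open>b \<le> C c\<close>, for which \<open>c \<Rightarrow> b\<close> is a one-line proof.\<close>

lemma S_infers_sound:
  assumes param: "L_parameterization S" and clo: "S_closure_operator S C"
    and inf: "S_infers S P \<phi>"
    and prem: "\<And>x y. (x, y) \<in> P \<Longrightarrow> y \<le> C x"
  shows "snd \<phi> \<le> C (fst \<phi>)"
proof -
  have ext: "x \<le> C x" and mono: "x \<le> y \<Longrightarrow> C x \<le> C y"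
    and sat: "(f, h) \<in> S \<Longrightarrow> C (h (C x)) \<le> h (C x)" for x y f h
    using clo by (auto simp: S_closure_operator_def)
  from inf show ?thesis
  proof cases
    case (ax a b)
    then show ?thesis using order_trans[OF sup_ge2 ext] by simp
  next
    case (cut a b c d)
    have "(id, id) \<in> S" using param by (simp add: L_parameterization_def)
    then have idem: "C (C x) \<le> C x" for x using sat[of id id x] by simp
    have "b \<le> C (sup a c)"
      using prem[OF cut(6)] mono[OF sup_ge1] by (rule order_trans)
    moreover have "c \<le> C (sup a c)"
      using sup_ge2 ext by (rule order_trans)
    \<comment> \<open>\<open>C (sup a c)\<close> bounds both \<open>b\<close> and \<open>c\<close>,
      hence their join; monotonicity leaves a double \<open>C\<close>, which \<open>idem\<close>
      removes.\<close>
    ultimately have "C (sup b c) \<le> C (C (sup a c))"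
      by (intro mono) simp
    with prem[OF cut(7)] have "d \<le> C (C (sup a c))" by (rule order_trans)
    then have "d \<le> C (sup a c)" using idem by (rule order_trans)
    then show ?thesis by (simp add: cut(1))
  next
    case (mul a b f h)
    have adj: "f x \<le> y \<longleftrightarrow> x \<le> h y" for x y
      using param mul(4) by (auto simp: L_parameterization_def isotone_galois_def)
    \<comment> \<open>Transpose of \<open>f a \<le> C (f a)\<close>. The goal
      \<open>f b \<le> C (f a)\<close> is likewise the transpose of the bound on \<open>b\<close>
      reached below.\<close>
    have "a \<le> h (C (f a))" using ext[of "f a"] by (simp add: adj)
    then have "C a \<le> h (C (f a))" by (rule order_trans[OF mono sat[OF mul(4)]])
    with prem[OF mul(5)] have "b \<le> h (C (f a))" by (rule order_trans)
    then show ?thesis using mul(1) adj by simp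
  qed
qed

text \<open>A rule may draw on any earlier entries of the proof, so strong induction on the position
  carries the invariant \<open>y \<le> C x\<close> along the list.\<close>

lemma S_provable_sound:
  assumes param: "L_parameterization S" and clo: "S_closure_operator S C"
    and ax: "\<And>x y. (x, y) \<in> \<Sigma> \<Longrightarrow> y \<le> C x"
    and prov: "S_provable S \<Sigma> a b"
  shows "b \<le> C a"
proof -
  obtain p where p: "is_S_proof S \<Sigma> p" "p \<noteq> []" "last p = (a, b)"
    using prov unfolding S_provable_def by blast
  have "snd (p ! i) \<le> C (fst (p ! i))" if "i < length p" for i
    using that
  proof (induction i rule: less_induct)
    case (less i)
    have prem: "y \<le> C x" if xy: "(x, y) \<in> set (take i p)" for x y
    proof -
      obtain j where "j < i" "p ! j = (x, y)"
        using xy by (auto simp: in_set_conv_nth)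
      then show ?thesis using less.IH[of j] less.prems by simp
    qed
    consider "p ! i \<in> \<Sigma>" | "S_infers S (set (take i p)) (p ! i)"
      using p(1) less.prems unfolding is_S_proof_def by blast
    then show ?case
    proof cases
      case 1
      then show ?thesis using ax by (metis prod.collapse)
    next
      case 2
      show ?thesis by (rule S_infers_sound[OF param clo 2 prem])
    qed
  qed
  \<comment> \<open>The proved formula is the last entry; \<open>p \<noteq> []\<close> makes
    \<open>length p - 1\<close> a valid index.\<close>
  from this[of "length p - 1"] show ?thesis
    using p(2,3) by (simp add: last_conv_nth)
qed

lemma S_provable_axiom: "(a, b) \<in> \<Sigma> \<Longrightarrow> S_provable S \<Sigma> a b"
  unfolding S_provable_def is_S_proof_def by (intro exI[of _ "[(a, b)]"]) simp

theorem theorem19: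
  fixes S :: "(('a::complete_lattice \<Rightarrow> 'a) \<times> ('a \<Rightarrow> 'a)) set" and C :: "'a \<Rightarrow> 'a"
  assumes "algebraic_lattice TYPE('a)"
    and "compact_L_parameterization S"
    and "algebraic_S_closure_operator S C"
  shows "C = closure_of_theory S (theory_of_closure C)"
proof (rule ext, rule antisym)
  fix a :: 'a
  have param: "L_parameterization S"
    using assms(2) by (simp add: compact_L_parameterization_def)
  have clo: "S_closure_operator S C"
    using assms(3) unfolding algebraic_S_closure_operator_def by (rule conjunct1)
  have "\<forall>a. C a = Sup {C c | c. c \<in> compact_elems \<and> c \<le> a}"
    using assms(3) unfolding algebraic_S_closure_operator_def by (rule conjunct2)
  \<comment> \<open>Fixed at this one \<open>a\<close>: for arbitrary arguments, unfolding the
    equation would apply again to each \<open>C c\<close> on its right-hand side.\<close>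
  then have alg: "C a = Sup {C c | c. c \<in> compact_elems \<and> c \<le> a}" by (rule spec)
  show "closure_of_theory S (theory_of_closure C) a \<le> C a"
    unfolding closure_of_theory_def
  proof (rule Sup_least, clarify)
    fix b c assume "c \<le> a" and prov: "S_provable S (theory_of_closure C) c b"
    have "b \<le> C c"
      by (rule S_provable_sound[OF param clo _ prov]) (simp add: theory_of_closure_def)
    also have "C c \<le> C a"
      using clo \<open>c \<le> a\<close> by (simp add: S_closure_operator_def)
    finally show "b \<le> C a" .
  qed
  have "C c \<le> closure_of_theory S (theory_of_closure C) a"
    if c: "c \<in> compact_elems" "c \<le> a" for c
  proof -
    \<comment> \<open>\<open>C c\<close> itself need not be compact, so \<open>(c, C c)\<close> need
      not be a formula of the theory; the compact elements joining to \<open>C c\<close> do give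
      such formulas.\<close>
    obtain A where A: "A \<subseteq> compact_elems" "C c = Sup A"
      using assms(1) unfolding algebraic_lattice_def by blast
    have "b \<le> closure_of_theory S (theory_of_closure C) a" if "b \<in> A" for b
    proof -
      have "b \<in> compact_elems" "b \<le> C c" using A that Sup_upper by auto
      then have "S_provable S (theory_of_closure C) c b"
        using c(1) by (intro S_provable_axiom) (simp add: theory_of_closure_def)
      with c \<open>b \<in> compact_elems\<close> show ?thesis
        unfolding closure_of_theory_def by (intro Sup_upper) blast
    qed
    then show ?thesis unfolding A(2) by (rule Sup_least)
  qed
  then show "C a \<le> closure_of_theory S (theory_of_closure C) a"
    unfolding alg by (intro Sup_least) blast
qed

end
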